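(* Let $(X,d)$ be a metric space and let $\mathcal{B}$ be a bornology on $X$ with a closed base such that the finest space $(C(X),\tau_F)$ for $(C(X),\tau_{\mathcal{B}})$ is quasibarreled. Then the following statements are equivalent: (1) the topology $\tau_{ucb}$ on the dual of $(C(X),\tau_{\mathcal{B}})$ is normable; (2) the topology $\tau_{ucb}$ on the dual of $(C(X),\tau_{\mathcal{B}}^s)$ is normable; (3) $\tau_{\mathcal{B}}$ is normable on $C(X)$; (4) $\tau_{\mathcal{B}}^s$ is normable on $C(X)$; (5) $X$ is compact and $X\in\mathcal{B}$.
   Context: $C(X)$ is the real vector space of continuous functions $X\to\mathbb{R}$. A bornology $\mathcal{B}$ on $X$ is a collection of non-empty subsets of $X$ that covers $X$ and is closed under finite unions and under taking (non-empty) subsets of its members; it has a closed base if every member of $\mathcal{B}$ is contained in a closed member of $\mathcal{B}$. For $B\subseteq X$ and $\delta>0$, $B^\delta=\bigcup_{y\in B}\{x\in X:d(x,y)<\delta\}$. For $B\in\mathcal{B}$ let $\rho_B(f)=\sup_{x\in B}|f(x)|\in[0,\infty]$ and $\rho_B^s(f)=\inf_{\delta>0}\sup_{x\in B^\delta}|f(x)|\in[0,\infty]$. $\tau_{\mathcal{B}}$, respectively $\tau_{\mathcal{B}}^s$, is the translation-invariant topology on $C(X)$ for which the sets $\rho_B^{-1}([0,r))$, respectively $(\rho_B^s)^{-1}([0,r))$ ($B\in\mathcal{B}$, $r>0$), form a neighborhood base at $0$. The dual of a space is the space of all continuous linear functionals into $\mathbb{R}$. Both spaces are extended locally convex spaces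 (elcs), i.e. vector spaces $Z$ whose topology $\tau$ is induced by a family of extended seminorms (functions with the properties of a seminorm that may take the value $\infty$). For an elcs $(Z,\tau)$, $\tau_F$ denotes the finest locally convex topology on $Z$ that is coarser than $\tau$, and $(Z,\tau_F)$ is called the finest space for $(Z,\tau)$. A subset $A$ of an elcs $(Z,\tau)$ is bounded if for every neighborhood $U$ of $0$ there exist $r>0$ and a finite set $E\subseteq Z$ with $A\subseteq E+rU$. $\tau_{ucb}$ is the locally convex topology on $Z^*$ induced by the seminorms $F\mapsto\sup_{x\in A}|F(x)|$, $A$ ranging over the bounded subsets of $(Z,\tau)$. A topology on a vector space is normable if it is induced by a norm. A locally convex space is quasibarreled if every absolutely convex closed set that absorbs all bounded sets is a neighborhood of $0$. *)

theory Defs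
  imports "HOL-Analysis.Analysis" "HOL-Library.Function_Algebras"
begin

section \<open>Pointwise vector space structure on functions\<close>

instantiation "fun" :: (type, real_vector) real_vector
begin

definition scaleR_fun :: "real \<Rightarrow> ('a \<Rightarrow> 'b) \<Rightarrow> 'a \<Rightarrow> 'b" where
  "scaleR_fun c f = (\<lambda>x. c *\<^sub>R f x)"

instance
proof
  fix a b :: real and f g :: "'a \<Rightarrow> 'b"
  show "a *\<^sub>R (f + g) = a *\<^sub>R f + a *\<^sub>R g"
    by (rule ext) (simp add: scaleR_fun_def scaleR_add_right)
  show "(a + b) *\<^sub>R f = a *\<^sub>R f + b *\<^sub>R f"
    by (rule ext) (simp add: scaleR_fun_def scaleR_add_left)
  show "a *\<^sub>R b *\<^sub>R f = (a * b) *\<^sub>R f"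
    by (rule ext) (simp add: scaleR_fun_def)
  show "1 *\<^sub>R f = f"
    by (rule ext) (simp add: scaleR_fun_def)
qed

end


section \<open>Extended seminorms and locally convex topologies\<close>

text \<open>
  Spaces are subspaces \<open>V\<close> of a real vector space type; a topology on \<open>V\<close> is a value of type
  \<open>_ topology\<close> whose underlying set is \<open>V\<close>. Note that \<open>0 * \<infinity> = 0\<close> in \<^typ>\<open>ennreal\<close>.
\<close>

definition ext_seminorm :: "('z::real_vector \<Rightarrow> ennreal) \<Rightarrow> bool" where
  "ext_seminorm p \<longleftrightarrow>
     (\<forall>c x. p (c *\<^sub>R x) = ennreal \<bar>c\<bar> * p x) \<and> (\<forall>x y. p (x + y) \<le> p x + p y)"

definition seminorm_topology ::
    "'z::real_vector set \<Rightarrow> ('z \<Rightarrow> ennreal) set \<Rightarrow> 'z topology" where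
  "seminorm_topology V P = topology (\<lambda>U. U \<subseteq> V \<and>
     (\<forall>x\<in>U. \<exists>F r. finite F \<and> F \<subseteq> P \<and> 0 < r \<and>
        {y \<in> V. \<forall>p\<in>F. p (y - x) < ennreal r} \<subseteq> U))"

definition elcs :: "'z::real_vector topology \<Rightarrow> bool" where
  "elcs T \<longleftrightarrow> (\<exists>P. (\<forall>p\<in>P. ext_seminorm p) \<and> T = seminorm_topology UNIV P)"

definition locally_convex :: "'z::real_vector topology \<Rightarrow> bool" where
  "locally_convex T \<longleftrightarrow>
     (\<exists>P. (\<forall>p\<in>P. ext_seminorm p \<and> (\<forall>x. p x < \<infinity>)) \<and> T = seminorm_topology UNIV P)"

definition coarser :: "'z topology \<Rightarrow> 'z topology \<Rightarrow> bool" where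
  "coarser S T \<longleftrightarrow> topspace S = topspace T \<and> (\<forall>U. openin S U \<longrightarrow> openin T U)"

definition is_finest_lc :: "'z::real_vector topology \<Rightarrow> 'z topology \<Rightarrow> bool" where
  "is_finest_lc T S \<longleftrightarrow> locally_convex S \<and> coarser S T \<and>
     (\<forall>S'. locally_convex S' \<and> coarser S' T \<longrightarrow> coarser S' S)"

definition finest_lc :: "'z::real_vector topology \<Rightarrow> 'z topology" where
  "finest_lc T = (THE S. is_finest_lc T S)"

definition normable :: "'z::real_vector set \<Rightarrow> 'z topology \<Rightarrow> bool" where
  "normable V T \<longleftrightarrow>
     (\<exists>N :: 'z \<Rightarrow> real.
        (\<forall>x\<in>V. 0 \<le> N x \<and> (N x = 0 \<longleftrightarrow> x = 0)) \<and>
        (\<forall>c. \<forall>x\<in>V. N (c *\<^sub>R x) = \<bar>c\<bar> * N x) \<and>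
        (\<forall>x\<in>V. \<forall>y\<in>V. N (x + y) \<le> N x + N y) \<and>
        T = seminorm_topology V {\<lambda>x. ennreal (N x)})"

definition bounded_in :: "'z::real_vector topology \<Rightarrow> 'z set \<Rightarrow> bool" where
  "bounded_in T A \<longleftrightarrow>
     (\<forall>U. 0 \<in> T interior_of U \<longrightarrow>
        (\<exists>r>0. \<exists>E. finite E \<and> A \<subseteq> {e + r *\<^sub>R u | e u. e \<in> E \<and> u \<in> U}))"

definition absolutely_convex :: "'z::real_vector set \<Rightarrow> bool" where
  "absolutely_convex S \<longleftrightarrow> convex S \<and> (\<forall>c. \<bar>c\<bar> \<le> 1 \<longrightarrow> (\<forall>x\<in>S. c *\<^sub>R x \<in> S))"

definition absorbs :: "'z::real_vector set \<Rightarrow> 'z set \<Rightarrow> bool" where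
  "absorbs S A \<longleftrightarrow> (\<exists>r>0. \<forall>c. r \<le> \<bar>c\<bar> \<longrightarrow> A \<subseteq> (*\<^sub>R) c ` S)"

definition quasibarreled :: "'z::real_vector topology \<Rightarrow> bool" where
  "quasibarreled T \<longleftrightarrow> locally_convex T \<and>
     (\<forall>S. absolutely_convex S \<and> closedin T S \<and> (\<forall>A. bounded_in T A \<longrightarrow> absorbs S A) \<longrightarrow>
        0 \<in> T interior_of S)"

definition dual :: "'z::real_vector topology \<Rightarrow> ('z \<Rightarrow> real) set" where
  "dual T = {F. linear F \<and> continuous_map T euclideanreal F}"

definition tau_ucb :: "'z::real_vector topology \<Rightarrow> ('z \<Rightarrow> real) topology" where
  "tau_ucb T = seminorm_topology (dual T)
     {\<lambda>F. SUP x\<in>A. ennreal \<bar>F x\<bar> | A. bounded_in T A}"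

text \<open>
  The translation-invariant topology having \<open>\<N>\<close> as a neighborhood base at \<open>0\<close>; meaningful when
  \<open>\<N>\<close> is such a base (see \<open>tau_B_eq\<close>, \<open>tau_Bs_eq\<close> and \<open>openin_nbhd_base\<close> below).
\<close>

definition nbhd_topology :: "'z::real_vector set set \<Rightarrow> 'z topology" where
  "nbhd_topology \<N> = topology (\<lambda>U. \<forall>z\<in>U. \<exists>N\<in>\<N>. (+) z ` N \<subseteq> U)"


section \<open>Spaces of continuous functions\<close>

typedef (overloaded) 'a cfun = "{f :: 'a::topological_space \<Rightarrow> real. continuous_on UNIV f}"
  morphisms apply_cfun Cfun
  by (intro exI[of _ "\<lambda>_. 0"]) simp

setup_lifting type_definition_cfun

instantiation cfun :: (topological_space) real_vector
begin

lift_definition zero_cfun :: "'a cfun" is "\<lambda>_. 0" by simp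
lift_definition plus_cfun :: "'a cfun \<Rightarrow> 'a cfun \<Rightarrow> 'a cfun" is "\<lambda>f g x. f x + g x"
  by (intro continuous_intros)
lift_definition uminus_cfun :: "'a cfun \<Rightarrow> 'a cfun" is "\<lambda>f x. - f x"
  by (intro continuous_intros)
lift_definition minus_cfun :: "'a cfun \<Rightarrow> 'a cfun \<Rightarrow> 'a cfun" is "\<lambda>f g x. f x - g x"
  by (intro continuous_intros)
lift_definition scaleR_cfun :: "real \<Rightarrow> 'a cfun \<Rightarrow> 'a cfun" is "\<lambda>c f x. c * f x"
  by (intro continuous_intros)

instance
proof
  fix a b :: real and f g h :: "'a cfun"
  show "f + g + h = f + (g + h)" by transfer (simp add: add.assoc)
  show "f + g = g + f" by transfer (simp add: add.commute)
  show "0 + f = f" by transfer simp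
  show "- f + f = 0" by transfer simp
  show "f - g = f + - g" by transfer simp
  show "a *\<^sub>R (f + g) = a *\<^sub>R f + a *\<^sub>R g" by transfer (simp add: distrib_left)
  show "(a + b) *\<^sub>R f = a *\<^sub>R f + b *\<^sub>R f" by transfer (simp add: distrib_right)
  show "a *\<^sub>R b *\<^sub>R f = (a * b) *\<^sub>R f" by transfer (simp add: mult.assoc)
  show "1 *\<^sub>R f = f" by transfer simp
qed

end

definition bornology :: "'a set set \<Rightarrow> bool" where
  "bornology \<B> \<longleftrightarrow> {} \<notin> \<B> \<and> \<Union>\<B> = UNIV \<and>
     (\<forall>A\<in>\<B>. \<forall>B\<in>\<B>. A \<union> B \<in> \<B>) \<and> (\<forall>B\<in>\<B>. \<forall>A. A \<subseteq> B \<and> A \<noteq> {} \<longrightarrow> A \<in> \<B>)"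

definition has_closed_base :: "'a::topological_space set set \<Rightarrow> bool" where
  "has_closed_base \<B> \<longleftrightarrow> (\<forall>B\<in>\<B>. \<exists>C\<in>\<B>. closed C \<and> B \<subseteq> C)"

definition enlargement :: "'a::metric_space set \<Rightarrow> real \<Rightarrow> 'a set" where
  "enlargement B \<delta> = (\<Union>y\<in>B. {x. dist x y < \<delta>})"

definition rho :: "'a::topological_space set \<Rightarrow> 'a cfun \<Rightarrow> ennreal" where
  "rho B f = (SUP x\<in>B. ennreal \<bar>apply_cfun f x\<bar>)"

definition rho_s :: "'a::metric_space set \<Rightarrow> 'a cfun \<Rightarrow> ennreal" where
  "rho_s B f = (INF \<delta>\<in>{0<..}. SUP x\<in>enlargement B \<delta>. ennreal \<bar>apply_cfun f x\<bar>)"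

definition tau_B :: "'a::metric_space set set \<Rightarrow> 'a cfun topology" where
  "tau_B \<B> = nbhd_topology {{f. rho B f < ennreal r} | B r. B \<in> \<B> \<and> 0 < r}"

definition tau_Bs :: "'a::metric_space set set \<Rightarrow> 'a cfun topology" where
  "tau_Bs \<B> = nbhd_topology {{f. rho_s B f < ennreal r} | B r. B \<in> \<B> \<and> 0 < r}"


section \<open>Well-definedness\<close>

lemma openin_seminorm_topology:
  "openin (seminorm_topology V P) U \<longleftrightarrow> U \<subseteq> V \<and>
     (\<forall>x\<in>U. \<exists>F r. finite F \<and> F \<subseteq> P \<and> 0 < r \<and>
        {y \<in> V. \<forall>p\<in>F. p (y - x) < ennreal r} \<subseteq> U)"
proof -
  define N where "N = (\<lambda>x U. \<exists>F r. finite F \<and> F \<subseteq> P \<and> 0 < r \<and>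
        {y \<in> V. \<forall>p\<in>F. p (y - x) < ennreal r} \<subseteq> U)"
  have N_mono: "N x U'" if NU: "N x U" and UU: "U \<subseteq> U'" for x U U'
  proof -
    obtain F r where F: "finite F" "F \<subseteq> P" "0 < r"
      "{y \<in> V. \<forall>p\<in>F. p (y - x) < ennreal r} \<subseteq> U" using NU unfolding N_def by (elim exE conjE)
    show ?thesis unfolding N_def
      using F(1-3) order_trans[OF F(4) UU] by (intro exI conjI)
  qed
  have N_Int: "N x (S \<inter> T)" if S: "N x S" and T: "N x T" for x S T
  proof -
    obtain F r where F: "finite F" "F \<subseteq> P" "0 < r"
      "{y \<in> V. \<forall>p\<in>F. p (y - x) < ennreal r} \<subseteq> S" using S unfolding N_def by (elim exE conjE)
    obtain G s where G: "finite G" "G \<subseteq> P" "0 < s"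
      "{y \<in> V. \<forall>p\<in>G. p (y - x) < ennreal s} \<subseteq> T" using T unfolding N_def by (elim exE conjE)
    have lt: "t < ennreal r \<and> t < ennreal s" if "t < ennreal (min r s)" for t
      using that less_le_trans[OF that ennreal_leI[OF min.cobounded1]]
        less_le_trans[OF that ennreal_leI[OF min.cobounded2]] by simp
    show ?thesis unfolding N_def
    proof (intro exI[of _ "F \<union> G"] exI[of _ "min r s"] conjI)
      show "finite (F \<union> G)" "F \<union> G \<subseteq> P" "0 < min r s" using F G by auto
      show "{y \<in> V. \<forall>p\<in>F \<union> G. p (y - x) < ennreal (min r s)} \<subseteq> S \<inter> T"
      proof
        fix y assume "y \<in> {y \<in> V. \<forall>p\<in>F \<union> G. p (y - x) < ennreal (min r s)}"
        then have "y \<in> {y \<in> V. \<forall>p\<in>F. p (y - x) < ennreal r}"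
          "y \<in> {y \<in> V. \<forall>p\<in>G. p (y - x) < ennreal s}" using lt by simp_all
        then show "y \<in> S \<inter> T" by (intro IntI subsetD[OF F(4)] subsetD[OF G(4)])
      qed
    qed
  qed
  have "istopology (\<lambda>U. U \<subseteq> V \<and> (\<forall>x\<in>U. N x U))"
    unfolding istopology_def
  proof (intro conjI allI impI)
    fix S T assume "S \<subseteq> V \<and> (\<forall>x\<in>S. N x S)" "T \<subseteq> V \<and> (\<forall>x\<in>T. N x T)"
    then show "S \<inter> T \<subseteq> V" "\<forall>x\<in>S \<inter> T. N x (S \<inter> T)" using N_Int by auto
  next
    fix \<K> assume K: "\<forall>K\<in>\<K>. K \<subseteq> V \<and> (\<forall>x\<in>K. N x K)"
    then show "\<Union>\<K> \<subseteq> V" by auto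
    show "\<forall>x\<in>\<Union>\<K>. N x (\<Union>\<K>)"
    proof
      fix x assume "x \<in> \<Union>\<K>"
      then obtain K where k: "K \<in> \<K>" "x \<in> K" by auto
      show "N x (\<Union>\<K>)"
        using N_mono[OF _ Union_upper[OF k(1)], of x] K k by simp
    qed
  qed
  then show ?thesis
    unfolding seminorm_topology_def N_def by (simp only: topology_inverse')
qed

lemma topspace_seminorm_topology [simp]: "topspace (seminorm_topology V P) = V"
proof -
  have "openin (seminorm_topology V P) V"
    unfolding openin_seminorm_topology by (auto intro!: exI[of _ "{}"] exI[of _ "1::real"])
  then show ?thesis
    using openin_seminorm_topology[of V P "topspace (seminorm_topology V P)"]
      openin_subset[of "seminorm_topology V P" V] by auto
qed

lemma ext_seminorm_zero: "ext_seminorm p \<Longrightarrow> p 0 = 0"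
  unfolding ext_seminorm_def by (metis abs_zero ennreal_0 mult_zero_left scaleR_zero_left)

lemma ext_seminorm_ball_open:
  assumes p: "ext_seminorm p" "p \<in> P"
  shows "openin (seminorm_topology UNIV P) {y. p (y - x) < ennreal r}"
  unfolding openin_seminorm_topology
proof (intro conjI subset_UNIV ballI)
  fix y assume "y \<in> {y. p (y - x) < ennreal r}"
  then have y: "p (y - x) < ennreal r" by simp
  then obtain a where a: "0 \<le> a" "p (y - x) = ennreal a"
    by (metis ennreal_cases ennreal_less_top less_top not_less_iff_gr_or_eq)
  have ar: "a < r" using y a by (simp add: ennreal_less_iff)
  have "{z \<in> UNIV. \<forall>q\<in>{p}. q (z - y) < ennreal (r - a)} \<subseteq> {y. p (y - x) < ennreal r}"
  proof clarsimp
    fix z assume z: "p (z - y) < ennreal (r - a)"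
    have "p (z - x) \<le> p (z - y) + p (y - x)"
      using p(1) unfolding ext_seminorm_def by (metis diff_add_cancel add_diff_eq)
    also have "\<dots> < ennreal (r - a) + ennreal a"
      using z a(2) by (simp add: ennreal_add_left_cancel_less add.commute)
    also have "\<dots> = ennreal r" using a(1) ar by (simp flip: ennreal_plus)
    finally show "p (z - x) < ennreal r" .
  qed
  then show "\<exists>F s. finite F \<and> F \<subseteq> P \<and> 0 < s \<and>
      {z \<in> UNIV. \<forall>q\<in>F. q (z - y) < ennreal s} \<subseteq> {y. p (y - x) < ennreal r}"
    using p(2) ar by (intro exI[of _ "{p}"] exI[of _ "r - a"]) auto
qed

lemma coarser_antisym: "coarser S T \<Longrightarrow> coarser T S \<Longrightarrow> S = T"
  unfolding coarser_def topology_eq by blast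

lemma is_finest_lc_finest_lc:
  assumes "topspace T = (UNIV :: 'z::real_vector set)"
  shows "is_finest_lc T (finest_lc T)"
proof -
  define Q where "Q = \<Union>{P. (\<forall>p\<in>P. ext_seminorm p \<and> (\<forall>x::'z. p x < \<infinity>)) \<and>
      coarser (seminorm_topology UNIV P) T}"
  have Q: "\<forall>p\<in>Q. ext_seminorm p \<and> (\<forall>x. p x < \<infinity>)" unfolding Q_def by auto
  have ball: "openin T {y. p (y - x) < ennreal r}" if "p \<in> Q" for p x r
  proof -
    from that obtain P where P: "P \<in> {P. (\<forall>p\<in>P. ext_seminorm p \<and> (\<forall>x. p x < \<infinity>)) \<and>
        coarser (seminorm_topology UNIV P) T}" "p \<in> P"
      unfolding Q_def by (rule UnionE)
    then show ?thesis using ext_seminorm_ball_open[of p P x r] by (simp add: coarser_def)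
  qed
  have Qc: "coarser (seminorm_topology UNIV Q) T"
    unfolding coarser_def
  proof (intro conjI allI impI)
    show "topspace (seminorm_topology UNIV Q) = topspace T" using assms by simp
    fix U assume U: "openin (seminorm_topology UNIV Q) U"
    show "openin T U"
    proof (subst openin_subopen, intro ballI)
      fix x assume x: "x \<in> U"
      obtain F r where F: "finite F" "F \<subseteq> Q" "0 < r"
        "{y \<in> UNIV. \<forall>p\<in>F. p (y - x) < ennreal r} \<subseteq> U"
        using U x unfolding openin_seminorm_topology by (elim conjE) (drule (1) bspec, elim exE conjE)
      have z: "p 0 = 0" if "p \<in> F" for p
        using Q F(2) that by (auto intro: ext_seminorm_zero)
      have "openin T {y. \<forall>p\<in>F. p (y - x) < ennreal r}"
        using F(1,2)
      proof (induction F)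
        case empty
        show ?case using openin_topspace[of T] assms by simp
      next
        case (insert p F)
        have "{y. \<forall>q\<in>insert p F. q (y - x) < ennreal r} =
            {y. p (y - x) < ennreal r} \<inter> {y. \<forall>q\<in>F. q (y - x) < ennreal r}" by auto
        then show ?case using insert ball by (simp add: openin_Int)
      qed
      moreover have "p (x - x) < ennreal r" if "p \<in> F" for p
        using z[OF that] F(3) by simp
      ultimately show "\<exists>W. openin T W \<and> x \<in> W \<and> W \<subseteq> U"
        using F(4) by (intro exI[of _ "{y. \<forall>p\<in>F. p (y - x) < ennreal r}"]) simp
    qed
  qed
  have max: "coarser S (seminorm_topology UNIV Q)" if S: "locally_convex S" "coarser S T" for S
  proof -
    obtain P where P: "\<forall>p\<in>P. ext_seminorm p \<and> (\<forall>x. p x < \<infinity>)" "S = seminorm_topology UNIV P"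
      using S(1) unfolding locally_convex_def by blast
    then have PQ: "P \<subseteq> Q" using S(2) unfolding Q_def by auto
    show ?thesis
      unfolding coarser_def
    proof (intro conjI allI impI)
      show "topspace S = topspace (seminorm_topology UNIV Q)" using P(2) by simp
      fix U assume U: "openin S U"
      show "openin (seminorm_topology UNIV Q) U"
        unfolding openin_seminorm_topology
      proof (intro conjI subset_UNIV ballI)
        fix x assume "x \<in> U"
        then obtain F r where F: "finite F" "F \<subseteq> P" "0 < r"
          "{y \<in> UNIV. \<forall>p\<in>F. p (y - x) < ennreal r} \<subseteq> U"
          using U unfolding P(2) openin_seminorm_topology by (elim conjE) (drule (1) bspec, elim exE conjE)
        show "\<exists>F r. finite F \<and> F \<subseteq> Q \<and> 0 < r \<and>
            {y \<in> UNIV. \<forall>p\<in>F. p (y - x) < ennreal r} \<subseteq> U"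
          using F(1) order_trans[OF F(2) PQ] F(3,4) by (intro exI conjI)
      qed
    qed
  qed
  have "is_finest_lc T (seminorm_topology UNIV Q)"
    unfolding is_finest_lc_def
  proof (intro conjI allI impI)
    show "locally_convex (seminorm_topology UNIV Q)"
      unfolding locally_convex_def using Q by (intro exI[of _ Q]) simp
  qed (use Qc max in auto)
  moreover have "S = S'" if "is_finest_lc T S" "is_finest_lc T S'" for S S'
    using that by (intro coarser_antisym) (auto simp: is_finest_lc_def)
  ultimately have "\<exists>!S. is_finest_lc T S" by (intro ex1I)
  then show ?thesis unfolding finest_lc_def by (rule theI')
qed

lemma ext_seminorm_rho: "ext_seminorm (rho B)"
  unfolding ext_seminorm_def
proof (intro conjI allI)
  fix c :: real and f g :: "'a cfun"
  show "rho B (c *\<^sub>R f) = ennreal \<bar>c\<bar> * rho B f"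
    unfolding rho_def
    by (simp add: scaleR_cfun.rep_eq abs_mult ennreal_mult' SUP_mult_left_ennreal)
  show "rho B (f + g) \<le> rho B f + rho B g"
    unfolding rho_def
  proof (rule SUP_least)
    fix x assume x: "x \<in> B"
    have "ennreal \<bar>apply_cfun (f + g) x\<bar> \<le> ennreal \<bar>apply_cfun f x\<bar> + ennreal \<bar>apply_cfun g x\<bar>"
      by (simp add: plus_cfun.rep_eq ennreal_leI abs_triangle_ineq flip: ennreal_plus)
    also have "\<dots> \<le> (SUP x\<in>B. ennreal \<bar>apply_cfun f x\<bar>) + (SUP x\<in>B. ennreal \<bar>apply_cfun g x\<bar>)"
      using x by (intro add_mono SUP_upper)
    finally show "ennreal \<bar>apply_cfun (f + g) x\<bar> \<le> \<dots>" .
  qed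
qed

lemma rho_mono: "A \<subseteq> B \<Longrightarrow> rho A f \<le> rho B f"
  unfolding rho_def by (rule SUP_subset_mono) auto

lemma rho_s_rho: "rho_s B f = (INF \<delta>\<in>{0<..}. rho (enlargement B \<delta>) f)"
  unfolding rho_s_def rho_def ..

lemma enlargement_mono: "A \<subseteq> B \<Longrightarrow> \<delta> \<le> \<epsilon> \<Longrightarrow> enlargement A \<delta> \<subseteq> enlargement B \<epsilon>"
  unfolding enlargement_def by fastforce

lemma rho_s_mono: "A \<subseteq> B \<Longrightarrow> rho_s A f \<le> rho_s B f"
  unfolding rho_s_rho by (intro INF_superset_mono order_refl rho_mono enlargement_mono)

lemma rho_s_less: "rho_s B f < t \<longleftrightarrow> (\<exists>\<delta>>0. rho (enlargement B \<delta>) f < t)"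
  unfolding rho_s_rho by (auto simp: INF_less_iff)

lemma ext_seminorm_rho_s: "ext_seminorm (rho_s B)"
  unfolding ext_seminorm_def
proof (intro conjI allI)
  have hom: "rho (enlargement B \<delta>) (c *\<^sub>R f) = ennreal \<bar>c\<bar> * rho (enlargement B \<delta>) f" for c \<delta> f
    using ext_seminorm_rho unfolding ext_seminorm_def by blast
  fix c :: real and f g :: "'a cfun"
  have le: "rho_s B (c *\<^sub>R f) \<le> ennreal \<bar>c\<bar> * rho_s B f" if "c \<noteq> 0" for c f
  proof -
    have ne: "ennreal \<bar>c\<bar> \<noteq> 0" "ennreal \<bar>c\<bar> \<noteq> top" using that by auto
    have "rho_s B (c *\<^sub>R f) / ennreal \<bar>c\<bar> \<le> rho_s B f"
      unfolding rho_s_rho[of B f]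
    proof (rule INF_greatest)
      fix \<delta> :: real assume d: "\<delta> \<in> {0<..}"
      have "rho_s B (c *\<^sub>R f) \<le> ennreal \<bar>c\<bar> * rho (enlargement B \<delta>) f"
        unfolding rho_s_rho hom[symmetric] using d by (rule INF_lower)
      then have "rho_s B (c *\<^sub>R f) / ennreal \<bar>c\<bar> \<le> ennreal \<bar>c\<bar> * rho (enlargement B \<delta>) f / ennreal \<bar>c\<bar>"
        by (rule divide_right_mono_ennreal)
      also have "\<dots> = rho (enlargement B \<delta>) f"
        using ennreal_mult_divide_eq[OF ne] by (simp only: mult.commute[of "ennreal \<bar>c\<bar>"])
      finally show "rho_s B (c *\<^sub>R f) / ennreal \<bar>c\<bar> \<le> rho (enlargement B \<delta>) f" .
    qed
    then have "ennreal \<bar>c\<bar> * (rho_s B (c *\<^sub>R f) / ennreal \<bar>c\<bar>) \<le> ennreal \<bar>c\<bar> * rho_s B f"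
      by (intro mult_left_mono) auto
    moreover have "ennreal \<bar>c\<bar> * (rho_s B (c *\<^sub>R f) / ennreal \<bar>c\<bar>) = rho_s B (c *\<^sub>R f)"
      using ennreal_mult_divide_eq[OF ne]
      by (simp only: ennreal_times_divide mult.commute[of "ennreal \<bar>c\<bar>"])
    ultimately show ?thesis by simp
  qed
  show "rho_s B (c *\<^sub>R f) = ennreal \<bar>c\<bar> * rho_s B f"
  proof (cases "c = 0")
    case True
    have "rho_s B (0 *\<^sub>R f) \<le> rho (enlargement B 1) (0 *\<^sub>R f)"
      unfolding rho_s_rho by (rule INF_lower) simp
    then show ?thesis using True by (simp only: hom) simp
  next
    case False
    have "ennreal \<bar>c\<bar> * rho_s B f = ennreal \<bar>c\<bar> * rho_s B (inverse c *\<^sub>R (c *\<^sub>R f))"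
      using False by simp
    also have "\<dots> \<le> ennreal \<bar>c\<bar> * (ennreal \<bar>inverse c\<bar> * rho_s B (c *\<^sub>R f))"
      using False by (intro mult_left_mono le) auto
    also have "\<dots> = rho_s B (c *\<^sub>R f)"
      using False by (simp add: mult.assoc[symmetric] flip: ennreal_mult'' abs_mult)
    finally show ?thesis using le[OF False, of f] by simp
  qed
  show "rho_s B (f + g) \<le> rho_s B f + rho_s B g"
  proof (rule ennreal_le_epsilon)
    fix e :: real assume e: "0 < e" and fin: "rho_s B f + rho_s B g < top"
    have half: "0 < ennreal (e / 2)" using e by simp
    have "rho_s B f < rho_s B f + ennreal (e / 2)" "rho_s B g < rho_s B g + ennreal (e / 2)"
      using fin half by (auto simp: ennreal_add_left_cancel_less)
    then obtain d d' where d: "0 < d" "rho (enlargement B d) f < rho_s B f + ennreal (e / 2)"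
      and d': "0 < d'" "rho (enlargement B d') g < rho_s B g + ennreal (e / 2)"
      unfolding rho_s_less by blast
    let ?E = "enlargement B (min d d')"
    have "rho_s B (f + g) \<le> rho ?E (f + g)"
      unfolding rho_s_rho using d(1) d'(1) by (intro INF_lower) simp
    also have "\<dots> \<le> rho ?E f + rho ?E g"
      using ext_seminorm_rho unfolding ext_seminorm_def by blast
    also have "\<dots> \<le> rho (enlargement B d) f + rho (enlargement B d') g"
      by (intro add_mono rho_mono enlargement_mono) auto
    also have "\<dots> \<le> (rho_s B f + ennreal (e / 2)) + (rho_s B g + ennreal (e / 2))"
      using d(2) d'(2) by (intro add_mono) auto
    also have "\<dots> = rho_s B f + rho_s B g + (ennreal (e / 2) + ennreal (e / 2))"
      by (simp add: ac_simps)
    also have "ennreal (e / 2) + ennreal (e / 2) = ennreal e"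
      using e by (simp flip: ennreal_plus)
    finally show "rho_s B (f + g) \<le> rho_s B f + rho_s B g + ennreal e" .
  qed
qed

lemma nbhd_topology_eq_seminorm_topology:
  fixes p :: "'a set \<Rightarrow> 'z::real_vector \<Rightarrow> ennreal"
  assumes B: "bornology \<B>"
    and mono: "\<And>A B f. A \<subseteq> B \<Longrightarrow> p A f \<le> p B f"
  shows "nbhd_topology {{f. p B f < ennreal r} | B r. B \<in> \<B> \<and> 0 < r} =
         seminorm_topology UNIV (p ` \<B>)"
proof -
  have ex: "\<exists>C\<in>\<B>. \<forall>A\<in>F. A \<subseteq> C" if "finite F" "F \<subseteq> \<B>" for F
    using that
  proof (induction F)
    case empty
    have "\<B> \<noteq> {}" using B unfolding bornology_def by auto
    then show ?case by blast
  next
    case (insert A F)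
    then obtain C where "C \<in> \<B>" "\<forall>A\<in>F. A \<subseteq> C" by auto
    moreover have "A \<union> C \<in> \<B>" using B insert.prems \<open>C \<in> \<B>\<close> unfolding bornology_def by blast
    ultimately show ?case by (intro bexI[of _ "A \<union> C"]) auto
  qed
  have img: "(+) z ` {f. p B f < ennreal r} = {y. p B (y - z) < ennreal r}" for z B r
  proof (intro set_eqI iffI)
    fix y assume "y \<in> {y. p B (y - z) < ennreal r}"
    then show "y \<in> (+) z ` {f. p B f < ennreal r}" by (intro image_eqI[of _ _ "y - z"]) simp_all
  qed auto
  have iff: "(\<exists>N\<in>{{f. p B f < ennreal r} | B r. B \<in> \<B> \<and> 0 < r}. (+) z ` N \<subseteq> U) \<longleftrightarrow>
      (\<exists>F r. finite F \<and> F \<subseteq> p ` \<B> \<and> 0 < r \<and> {y \<in> UNIV. \<forall>q\<in>F. q (y - z) < ennreal r} \<subseteq> U)"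
    (is "?l \<longleftrightarrow> ?r") for z U
  proof
    assume ?l
    then obtain N where N: "N \<in> {{f. p B f < ennreal r} | B r. B \<in> \<B> \<and> 0 < r}" "(+) z ` N \<subseteq> U"
      by (elim bexE)
    from N(1) obtain B r where Br: "N = {f. p B f < ennreal r}" "B \<in> \<B>" "0 < r"
      by (elim CollectE exE conjE)
    show ?r
      using N(2) Br by (intro exI[of _ "{p B}"] exI[of _ r]) (simp add: img)
  next
    assume ?r
    then obtain F r where F: "finite F" "F \<subseteq> p ` \<B>" "0 < r"
      "{y \<in> UNIV. \<forall>q\<in>F. q (y - z) < ennreal r} \<subseteq> U" by (elim exE conjE)
    obtain G where G: "finite G" "G \<subseteq> \<B>" "F = p ` G"
      using finite_subset_image[OF F(1,2)] by blast
    obtain C where C: "C \<in> \<B>" "\<forall>A\<in>G. A \<subseteq> C" using ex[OF G(1,2)] by blast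
    have "p A (y - z) < ennreal r" if "A \<in> G" "p C (y - z) < ennreal r" for A y
      using le_less_trans[OF mono that(2)] C(2) that(1) by simp
    then have "{y. p C (y - z) < ennreal r} \<subseteq> {y \<in> UNIV. \<forall>q\<in>F. q (y - z) < ennreal r}"
      unfolding G(3) by auto
    then have "(+) z ` {f. p C f < ennreal r} \<subseteq> U"
      unfolding img using F(4) by (rule order_trans)
    moreover have "{f. p C f < ennreal r} \<in> {{f. p B f < ennreal r} | B r. B \<in> \<B> \<and> 0 < r}"
      unfolding mem_Collect_eq
      by (intro exI[of _ C] exI[of _ r] conjI C(1) F(3)) (rule refl)
    ultimately show ?l by (rule bexI)
  qed
  have "openin (seminorm_topology UNIV (p ` \<B>)) =
      (\<lambda>U. \<forall>z\<in>U. \<exists>N\<in>{{f. p B f < ennreal r} | B r. B \<in> \<B> \<and> 0 < r}. (+) z ` N \<subseteq> U)"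
    unfolding iff by (rule ext) (simp only: openin_seminorm_topology subset_UNIV simp_thms)
  then show ?thesis
    unfolding nbhd_topology_def by (metis openin_inverse)
qed

lemma tau_B_eq: "bornology \<B> \<Longrightarrow> tau_B \<B> = seminorm_topology UNIV (rho ` \<B>)"
  unfolding tau_B_def by (intro nbhd_topology_eq_seminorm_topology rho_mono)

lemma tau_Bs_eq: "bornology \<B> \<Longrightarrow> tau_Bs \<B> = seminorm_topology UNIV (rho_s ` \<B>)"
  unfolding tau_Bs_def by (intro nbhd_topology_eq_seminorm_topology rho_s_mono)

lemma elcs_tau_B: "bornology \<B> \<Longrightarrow> elcs (tau_B \<B>)"
  unfolding elcs_def using tau_B_eq ext_seminorm_rho by blast

lemma elcs_tau_Bs: "bornology \<B> \<Longrightarrow> elcs (tau_Bs \<B>)"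
  unfolding elcs_def using tau_Bs_eq ext_seminorm_rho_s by blast

lemma is_finest_lc_tau_B: "bornology \<B> \<Longrightarrow> is_finest_lc (tau_B \<B>) (finest_lc (tau_B \<B>))"
  by (rule is_finest_lc_finest_lc) (simp add: tau_B_eq)

lemma openin_nbhd_base:
  assumes "bornology \<B>" "B \<in> \<B>"
  shows "openin (tau_B \<B>) {f. rho B f < ennreal r}"
    and "openin (tau_Bs \<B>) {f. rho_s B f < ennreal r}"
  using ext_seminorm_ball_open[OF ext_seminorm_rho, of B "rho ` \<B>" 0 r]
    ext_seminorm_ball_open[OF ext_seminorm_rho_s, of B "rho_s ` \<B>" 0 r]
    assms by (simp_all add: tau_B_eq tau_Bs_eq)

end

theory Submission
  imports Defs
begin

text \<open>
  The implications that start from a norm are the familiar ones: a norm on \<open>C(X)\<close> yields the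
  operator norm on its dual (\<open>normable_imp_normable_ucb\<close>), and for compact \<open>X \<in> \<B>\<close> the supremum
  norm \<open>rho UNIV\<close> dominates all the \<open>rho B\<close> (\<open>normable_tau_B_if_compact\<close>). What has to be explained
  is why a normable dual forces \<open>X\<close> to be compact and to belong to \<open>\<B>\<close>.

  A norm inducing \<open>tau_ucb\<close> is dominated by finitely many of the seminorms
  \<open>F \<mapsto> sup {\<bar>F f\<bar> | f \<in> A}\<close> with \<open>A\<close> bounded, and in turn dominates all of them. On the evaluations
  at points of \<open>X\<close> this says that a single function \<open>g \<ge> 0\<close> on \<open>X\<close> satisfies \<open>\<bar>f\<bar> \<le> C g\<close> on \<open>X\<close>
  for all \<open>f\<close> in a given bounded set, with a constant \<open>C\<close> depending only on that set
  (\<open>normable_ucb_imp_dominating_weight\<close>). Singletons are bounded, so every continuous function is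
  bounded by a multiple of \<open>g\<close>. In a non-compact metric space this fails: along a closed discrete
  sequence a continuous function may outgrow all multiples of \<open>g\<close>
  (\<open>dominating_weight_imp_compact\<close>). Evaluations are continuous for
  \<open>tau_B\<close> and for \<open>tau_Bs\<close>, so that a normable dual of either space makes \<open>X\<close> compact.

  Once \<open>X\<close> is compact, uniform continuity identifies \<open>tau_Bs\<close> with \<open>tau_B\<close>, and all suprema are
  finite, so that \<open>tau_B\<close> is locally convex and equals its own finest locally convex topology. The
  set of the \<open>f\<close> with \<open>\<bar>f\<bar> \<le> g\<close> is absolutely convex, closed and, by the choice of \<open>g\<close>, absorbs all
  bounded sets; quasibarreledness makes it a neighborhood of \<open>0\<close>. Hence it contains every function
  that is small enough on some closed \<open>C \<in> \<B>\<close>, which is possible only for \<open>C = X\<close>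
  (\<open>weight_ball_nbhd_imp_UNIV_mem\<close>).
\<close>

section \<open>Seminorm topologies and normability\<close>

lemma ext_seminorm_scaleR: "ext_seminorm p \<Longrightarrow> p (c *\<^sub>R x) = ennreal \<bar>c\<bar> * p x"
  unfolding ext_seminorm_def by blast

lemma openin_seminorm_topologyE:
  assumes "openin (seminorm_topology V P) U" "x \<in> U"
  obtains F r where "finite F" "F \<subseteq> P" "0 < r" "{y \<in> V. \<forall>p\<in>F. p (y - x) < ennreal r} \<subseteq> U"
  using assms unfolding openin_seminorm_topology by (elim conjE) (drule (1) bspec, elim exE conjE)

lemma openin_seminorm_topology_restrict:
  assumes U: "openin (seminorm_topology UNIV P) U"
  shows "openin (seminorm_topology V P) (V \<inter> U)"
  unfolding openin_seminorm_topology
proof (intro conjI ballI)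
  fix x assume x: "x \<in> V \<inter> U"
  obtain F r where "finite F" "F \<subseteq> P" "0 < r" "{y \<in> UNIV. \<forall>p\<in>F. p (y - x) < ennreal r} \<subseteq> U"
    using openin_seminorm_topologyE[OF U IntD2[OF x]] .
  then show "\<exists>F r. finite F \<and> F \<subseteq> P \<and> 0 < r \<and>
      {y \<in> V. \<forall>p\<in>F. p (y - x) < ennreal r} \<subseteq> V \<inter> U"
    by (intro exI[of _ F] exI[of _ r]) auto
qed auto

text \<open>
  The radius in the \<open>Q\<close>-neighborhood is the smallest of the finitely many radii \<open>r / C p\<close>; the
  extra \<open>1\<close> covers an empty set of seminorms.
\<close>

lemma openin_seminorm_topology_dominated:
  fixes V :: "'z::real_vector set"
  assumes V: "subspace V"
    and dom: "\<And>p. p \<in> P \<Longrightarrow> \<exists>q\<in>Q. \<exists>C>0. \<forall>x\<in>V. p x \<le> ennreal C * q x"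
    and U: "openin (seminorm_topology V P) U"
  shows "openin (seminorm_topology V Q) U"
proof -
  have "\<forall>p\<in>P. \<exists>q. q \<in> Q \<and> (\<exists>C>0. \<forall>x\<in>V. p x \<le> ennreal C * q x)" using dom by blast
  from bchoice[OF this] obtain d where
    d: "\<And>p. p \<in> P \<Longrightarrow> d p \<in> Q" "\<forall>p\<in>P. \<exists>C. C > 0 \<and> (\<forall>x\<in>V. p x \<le> ennreal C * d p x)"
    by blast
  from bchoice[OF d(2)] obtain C where
    C: "\<And>p. p \<in> P \<Longrightarrow> C p > 0" "\<And>p x. p \<in> P \<Longrightarrow> x \<in> V \<Longrightarrow> p x \<le> ennreal (C p) * d p x"
    by blast
  have UV: "U \<subseteq> V" using openin_subset[OF U] by simp
  show ?thesis
    unfolding openin_seminorm_topology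
  proof (intro conjI UV ballI)
    fix x assume x: "x \<in> U"
    obtain F r where F: "finite F" "F \<subseteq> P" "0 < r" "{y \<in> V. \<forall>p\<in>F. p (y - x) < ennreal r} \<subseteq> U"
      using openin_seminorm_topologyE[OF U x] .
    define s where "s = Min (insert 1 ((\<lambda>p. r / C p) ` F))"
    have s0: "s > 0" unfolding s_def using F C by (subst Min_gr_iff) auto
    have s: "s \<le> r / C p" if "p \<in> F" for p
      unfolding s_def using F(1) that by (intro Min_le) auto
    have "{y \<in> V. \<forall>q\<in>d ` F. q (y - x) < ennreal s} \<subseteq> U"
    proof
      fix y assume y: "y \<in> {y \<in> V. \<forall>q\<in>d ` F. q (y - x) < ennreal s}"
      have yx: "y - x \<in> V" using V x y UV by (auto intro: subspace_diff)
      have "p (y - x) < ennreal r" if p: "p \<in> F" for p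
      proof -
        have hp: "C p > 0" "p (y - x) \<le> ennreal (C p) * d p (y - x)"
          using C F(2) p yx by auto
        note hp(2)
        also have "ennreal (C p) * d p (y - x) < ennreal (C p) * ennreal s"
          using y p hp(1) by (intro ennreal_mult_strict_left_mono) auto
        also have "\<dots> = ennreal (C p * s)" using hp(1) s0 by (simp add: ennreal_mult)
        also have "\<dots> \<le> ennreal r"
          using s[OF p] hp(1) by (intro ennreal_leI) (simp add: field_simps)
        finally show ?thesis .
      qed
      then show "y \<in> U" using F(4) y by auto
    qed
    then show "\<exists>G s. finite G \<and> G \<subseteq> Q \<and> 0 < s \<and> {y \<in> V. \<forall>q\<in>G. q (y - x) < ennreal s} \<subseteq> U"
      using F d(1) s0 by (intro exI[of _ "d ` F"] exI[of _ s]) auto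
  qed
qed

lemma seminorm_topology_eqI:
  fixes V :: "'z::real_vector set"
  assumes "subspace V"
    and "\<And>p. p \<in> P \<Longrightarrow> \<exists>q\<in>Q. \<exists>C>0. \<forall>x\<in>V. p x \<le> ennreal C * q x"
    and "\<And>q. q \<in> Q \<Longrightarrow> \<exists>p\<in>P. \<exists>C>0. \<forall>x\<in>V. q x \<le> ennreal C * p x"
  shows "seminorm_topology V P = seminorm_topology V Q"
  unfolding topology_eq
  using openin_seminorm_topology_dominated[OF assms(1,2)]
    openin_seminorm_topology_dominated[OF assms(1,3)] by blast

lemma normable_of_dominating_norm:
  fixes V :: "'z::real_vector set"
  assumes V: "subspace V" and q: "ext_seminorm q" "q \<in> P"
    and fin: "\<And>x. x \<in> V \<Longrightarrow> q x < \<infinity>" and def: "\<And>x. x \<in> V \<Longrightarrow> q x = 0 \<Longrightarrow> x = 0"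
    and dom: "\<And>p. p \<in> P \<Longrightarrow> \<exists>C>0. \<forall>x\<in>V. p x \<le> ennreal C * q x"
  shows "normable V (seminorm_topology V P)"
  unfolding normable_def
proof (intro exI[of _ "\<lambda>x. enn2real (q x)"] conjI ballI allI)
  have eq: "ennreal (enn2real (q x)) = q x" if "x \<in> V" for x
    using fin[OF that] by (simp add: less_top)
  fix x assume x: "x \<in> V"
  show "0 \<le> enn2real (q x)" by simp
  show "enn2real (q x) = 0 \<longleftrightarrow> x = 0"
    using eq[OF x] def[OF x] ext_seminorm_zero[OF q(1)] by auto
  show "enn2real (q (c *\<^sub>R x)) = \<bar>c\<bar> * enn2real (q x)" for c
    using ext_seminorm_scaleR[OF q(1)] by (simp add: enn2real_mult)
  fix y assume y: "y \<in> V"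
  have "q (x + y) \<le> q x + q y" using q(1) unfolding ext_seminorm_def by blast
  then have "enn2real (q (x + y)) \<le> enn2real (q x + q y)"
    using fin[OF x] fin[OF y] by (intro enn2real_mono) auto
  then show "enn2real (q (x + y)) \<le> enn2real (q x) + enn2real (q y)"
    using fin[OF x] fin[OF y] by (simp add: enn2real_plus)
next
  have eq: "ennreal (enn2real (q x)) = q x" if "x \<in> V" for x
    using fin[OF that] by (simp add: less_top)
  show "seminorm_topology V P = seminorm_topology V {\<lambda>x. ennreal (enn2real (q x))}"
  proof (rule seminorm_topology_eqI[OF V])
    fix p assume "p \<in> P"
    then show "\<exists>r\<in>{\<lambda>x. ennreal (enn2real (q x))}. \<exists>C>0. \<forall>x\<in>V. p x \<le> ennreal C * r x"
      using dom eq by simp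
  next
    fix r assume "r \<in> {\<lambda>x. ennreal (enn2real (q x))}"
    then show "\<exists>p\<in>P. \<exists>C>0. \<forall>x\<in>V. r x \<le> ennreal C * p x"
      using q(2) eq by (intro bexI[of _ q] exI[of _ 1]) auto
  qed
qed

text \<open>
  Both the unit ball of the norm and the unit ball of \<open>q\<close> are neighborhoods of \<open>0\<close> for the same
  topology, so the norm is dominated by finitely many members of \<open>P\<close> and dominates each of them.
  The finite family is kept as a hypothesis \<open>p x \<le> t\<close> for all its members, which spares forming a
  maximum that may be infinite or empty.
\<close>

lemma normable_imp_dominating_family:
  fixes V :: "'z::real_vector set"
  assumes V: "subspace V" and P: "\<And>p. p \<in> P \<Longrightarrow> ext_seminorm p"
    and norm: "normable V (seminorm_topology V P)"
  obtains F where "finite F" "F \<subseteq> P" "\<And>q x. q \<in> P \<Longrightarrow> x \<in> V \<Longrightarrow> q x < \<infinity>"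
    "\<And>q. q \<in> P \<Longrightarrow>
       \<exists>C>0. \<forall>x\<in>V. \<forall>t\<ge>0. (\<forall>p\<in>F. p x \<le> ennreal t) \<longrightarrow> q x \<le> ennreal (C * t)"
proof -
  obtain N :: "'z \<Rightarrow> real" where
    N: "\<forall>x\<in>V. 0 \<le> N x \<and> (N x = 0 \<longleftrightarrow> x = 0)" "\<forall>c. \<forall>x\<in>V. N (c *\<^sub>R x) = \<bar>c\<bar> * N x"
      "\<forall>x\<in>V. \<forall>y\<in>V. N (x + y) \<le> N x + N y"
    and T: "seminorm_topology V P = seminorm_topology V {\<lambda>x. ennreal (N x)}"
    using norm unfolding normable_def by (elim exE conjE)
  have N0: "0 \<le> N x" "N x = 0 \<longleftrightarrow> x = 0" and Nc: "N (c *\<^sub>R x) = \<bar>c\<bar> * N x" if "x \<in> V" for x c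
    using N(1,2) that by auto
  have Na: "N (x + y) \<le> N x + N y" if "x \<in> V" "y \<in> V" for x y
    using N(3) that by blast
  have z: "0 \<in> V" using V by (rule subspace_0)
  have bound: "\<exists>C>0. \<forall>x\<in>V. q x \<le> ennreal (C * N x)" if q: "q \<in> P" for q
  proof -
    have "openin (seminorm_topology UNIV P) {y. q (y - 0) < ennreal 1}"
      by (rule ext_seminorm_ball_open[OF P[OF q] q])
    then have "openin (seminorm_topology V P) (V \<inter> {y. q (y - 0) < ennreal 1})"
      by (rule openin_seminorm_topology_restrict)
    moreover have "V \<inter> {y. q (y - 0) < ennreal 1} = {y \<in> V. q y < 1}" by auto
    ultimately have op: "openin (seminorm_topology V {\<lambda>x. ennreal (N x)}) {y \<in> V. q y < 1}"
      using T by simp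
    have mem: "0 \<in> {y \<in> V. q y < 1}" using z ext_seminorm_zero[OF P[OF q]] by simp
    obtain F r where F: "finite F" "F \<subseteq> {\<lambda>x. ennreal (N x)}" "0 < r"
      "{y \<in> V. \<forall>p\<in>F. p (y - 0) < ennreal r} \<subseteq> {y \<in> V. q y < 1}"
      using openin_seminorm_topologyE[OF op mem] .
    have small: "q y < 1" if "y \<in> V" "N y < r" for y
    proof -
      have "\<forall>p\<in>F. p (y - 0) < ennreal r" using F(2,3) that(2) by (auto simp: ennreal_lessI)
      then have "y \<in> {y \<in> V. q y < 1}" by (intro subsetD[OF F(4)]) (simp add: that(1))
      then show ?thesis by simp
    qed
    have "q x \<le> ennreal (2 / r * N x)" if x: "x \<in> V" for x
    proof (cases "x = 0")
      case True
      then show ?thesis using ext_seminorm_zero[OF P[OF q]] by simp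
    next
      case False
      then have Np: "N x > 0" using N0[OF x] by force
      define y where "y = (r / (2 * N x)) *\<^sub>R x"
      have "y \<in> V" unfolding y_def using V x by (rule subspace_scale)
      moreover have "N y < r" unfolding y_def using Nc[OF x] Np F(3) by simp
      ultimately have qy: "q y < 1" by (rule small)
      have "x = (2 / r * N x) *\<^sub>R y" unfolding y_def using Np F(3) by simp
      then have "q x = ennreal (2 / r * N x) * q y"
        using ext_seminorm_scaleR[OF P[OF q], of "2 / r * N x" y] Np F(3) by simp
      also have "\<dots> \<le> ennreal (2 / r * N x) * 1" using qy by (intro mult_left_mono) auto
      finally show ?thesis by simp
    qed
    then show ?thesis using F(3) by (intro exI[of _ "2 / r"]) auto
  qed
  have "openin (seminorm_topology V {\<lambda>x. ennreal (N x)}) {x \<in> V. N x < 1}"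
    unfolding openin_seminorm_topology
  proof (intro conjI ballI)
    fix x assume x: "x \<in> {x \<in> V. N x < 1}"
    have "y \<in> {x \<in> V. N x < 1}" if "y \<in> V" "ennreal (N (y - x)) < ennreal (1 - N x)" for y
    proof -
      have yx: "y - x \<in> V" using V that x by (auto intro: subspace_diff)
      have "N y \<le> N (y - x) + N x" using Na[OF yx, of x] x by simp
      moreover have "N (y - x) < 1 - N x" using that(2) N0(1)[OF yx] by (simp add: ennreal_less_iff)
      ultimately show ?thesis using that by simp
    qed
    then show "\<exists>F r. finite F \<and> F \<subseteq> {\<lambda>x. ennreal (N x)} \<and> 0 < r \<and>
        {y \<in> V. \<forall>p\<in>F. p (y - x) < ennreal r} \<subseteq> {x \<in> V. N x < 1}"
      using x by (intro exI[of _ "{\<lambda>x. ennreal (N x)}"] exI[of _ "1 - N x"]) auto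
  qed simp
  then have op: "openin (seminorm_topology V P) {x \<in> V. N x < 1}" using T by simp
  have mem: "0 \<in> {x \<in> V. N x < 1}" using z N0(2)[OF z] by simp
  obtain F r where F: "finite F" "F \<subseteq> P" "0 < r"
    "{y \<in> V. \<forall>p\<in>F. p (y - 0) < ennreal r} \<subseteq> {x \<in> V. N x < 1}"
    using openin_seminorm_topologyE[OF op mem] .
  have Nle: "N x \<le> 2 / r * t" if x: "x \<in> V" and t: "\<forall>p\<in>F. p x \<le> ennreal t" "t > 0" for x t
  proof -
    define y where "y = (r / (2 * t)) *\<^sub>R x"
    have yV: "y \<in> V" unfolding y_def using V x by (rule subspace_scale)
    have "p y < ennreal r" if p: "p \<in> F" for p
    proof -
      have "p y = ennreal (r / (2 * t)) * p x"
        unfolding y_def using ext_seminorm_scaleR[OF P[OF subsetD[OF F(2) p]]] F(3) t(2) by simp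
      also have "\<dots> \<le> ennreal (r / (2 * t)) * ennreal t"
        using t p by (intro mult_left_mono) auto
      also have "\<dots> = ennreal (r / 2)" using t F(3) by (simp flip: ennreal_mult)
      also have "\<dots> < ennreal r" using F(3) by (intro ennreal_lessI) auto
      finally show ?thesis .
    qed
    then have "y \<in> {x \<in> V. N x < 1}" using yV by (intro subsetD[OF F(4)]) simp
    then have "N y < 1" by simp
    then show ?thesis unfolding y_def using Nc[OF x] t F(3) by (simp add: field_simps)
  qed
  \<comment> \<open>For \<open>t = 0\<close> there is no rescaling of \<open>x\<close> to the boundary; approach \<open>t\<close> from above.\<close>
  have Nle0: "N x \<le> 2 / r * t" if x: "x \<in> V" and t: "\<forall>p\<in>F. p x \<le> ennreal t" "t \<ge> 0" for x t
  proof (rule field_le_epsilon)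
    fix e :: real assume e: "e > 0"
    have "\<forall>p\<in>F. p x \<le> ennreal (t + e * r / 2)"
    proof
      fix p assume "p \<in> F"
      then have "p x \<le> ennreal t" using t(1) by blast
      also have "\<dots> \<le> ennreal (t + e * r / 2)" using e F(3) by (intro ennreal_leI) simp
      finally show "p x \<le> ennreal (t + e * r / 2)" .
    qed
    then have "N x \<le> 2 / r * (t + e * r / 2)"
      using x t(2) e F(3) by (intro Nle) (auto intro: add_nonneg_pos)
    then show "N x \<le> 2 / r * t + e" using F(3) by (simp add: field_simps)
  qed
  show ?thesis
  proof (rule that[of F])
    fix q assume q: "q \<in> P"
    obtain C where C: "C > 0" "\<And>x. x \<in> V \<Longrightarrow> q x \<le> ennreal (C * N x)" using bound[OF q] by blast
    show "q x < \<infinity>" if "x \<in> V" for x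
      using C(2)[OF that] by (metis ennreal_less_top infinity_ennreal_def le_less_trans)
    show "\<exists>C>0. \<forall>x\<in>V. \<forall>t\<ge>0. (\<forall>p\<in>F. p x \<le> ennreal t) \<longrightarrow> q x \<le> ennreal (C * t)"
    proof (intro exI[of _ "C * (2 / r)"] conjI ballI allI impI)
      fix x t assume x: "x \<in> V" and t: "(0::real) \<le> t" "\<forall>p\<in>F. p x \<le> ennreal t"
      have "C * N x \<le> C * (2 / r) * t" using mult_left_mono[OF Nle0[OF x t(2,1)], of C] C(1) by simp
      then show "q x \<le> ennreal (C * (2 / r) * t)"
        using C(2)[OF x] by (meson ennreal_leI order_trans)
    qed (use C(1) F(3) in simp)
  qed (rule F)+
qed


section \<open>Duals\<close>

lemma subspace_dual: "subspace (dual T)"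
  unfolding subspace_def dual_def
  by (auto simp: linear_iff plus_fun_def scaleR_fun_def zero_fun_def algebra_simps
      intro!: continuous_map_add continuous_map_real_mult_left)

lemma dual_dominatedI:
  assumes F: "linear F" and p: "p \<in> P" "\<And>x. ennreal \<bar>F x\<bar> \<le> p x"
  shows "F \<in> dual (seminorm_topology UNIV P)"
proof -
  have "openin (seminorm_topology UNIV P) {x. F x \<in> U}" if U: "open U" for U
    unfolding openin_seminorm_topology
  proof (intro conjI subset_UNIV ballI)
    fix x assume "x \<in> {x. F x \<in> U}"
    then obtain e where e: "e > 0" "ball (F x) e \<subseteq> U" using U open_contains_ball by blast
    have "F y \<in> U" if "p (y - x) < ennreal e" for y
    proof -
      have "ennreal \<bar>F (y - x)\<bar> < ennreal e" using p(2) that by (rule le_less_trans)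
      then have "\<bar>F y - F x\<bar> < e" using linear_diff[OF F] by (simp add: ennreal_less_iff)
      then show ?thesis using e(2) by (auto simp: dist_real_def abs_minus_commute)
    qed
    then show "\<exists>G r. finite G \<and> G \<subseteq> P \<and> 0 < r \<and>
        {y \<in> UNIV. \<forall>p\<in>G. p (y - x) < ennreal r} \<subseteq> {x. F x \<in> U}"
      using e p(1) by (intro exI[of _ "{p}"] exI[of _ e]) auto
  qed
  then show ?thesis using F unfolding dual_def continuous_map by simp
qed

lemma dual_bounded_on_unit_ball:
  assumes q: "ext_seminorm q" and F: "F \<in> dual (seminorm_topology UNIV {q})"
  obtains C where "\<And>x. q x \<le> 1 \<Longrightarrow> \<bar>F x\<bar> \<le> C"
proof -
  have lin: "linear F" and cont: "continuous_map (seminorm_topology UNIV {q}) euclideanreal F"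
    using F unfolding dual_def by auto
  have op: "openin (seminorm_topology UNIV {q}) {x. F x \<in> ball 0 1}"
    using openin_continuous_map_preimage[OF cont, of "ball 0 1"] by simp
  have mem: "0 \<in> {x. F x \<in> ball 0 1}" using linear_0[OF lin] by simp
  obtain G r where G: "finite G" "G \<subseteq> {q}" "0 < r"
    "{y \<in> UNIV. \<forall>p\<in>G. p (y - 0) < ennreal r} \<subseteq> {x. F x \<in> ball 0 1}"
    using openin_seminorm_topologyE[OF op mem] .
  have "\<bar>F x\<bar> \<le> 2 / r" if x: "q x \<le> 1" for x
  proof -
    have "q ((r / 2) *\<^sub>R x) = ennreal (r / 2) * q x" using ext_seminorm_scaleR[OF q] G(3) by simp
    also have "\<dots> \<le> ennreal (r / 2) * 1" using x by (intro mult_left_mono) auto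
    also have "\<dots> < ennreal r" using G(3) by (simp add: ennreal_lessI)
    finally have "(r / 2) *\<^sub>R x \<in> {x. F x \<in> ball 0 1}" using G by auto
    then show ?thesis using linear_scale[OF lin] G(3) by (simp add: abs_mult field_simps)
  qed
  then show ?thesis by (rule that)
qed

lemma ext_seminorm_sup_on: "ext_seminorm (\<lambda>F :: 'z \<Rightarrow> real. SUP x\<in>A. ennreal \<bar>F x\<bar>)"
  unfolding ext_seminorm_def
proof (intro conjI allI)
  fix c :: real and F G :: "'z \<Rightarrow> real"
  show "(SUP x\<in>A. ennreal \<bar>(c *\<^sub>R F) x\<bar>) = ennreal \<bar>c\<bar> * (SUP x\<in>A. ennreal \<bar>F x\<bar>)"
    by (simp add: scaleR_fun_def abs_mult ennreal_mult' SUP_mult_left_ennreal)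
  show "(SUP x\<in>A. ennreal \<bar>(F + G) x\<bar>) \<le> (SUP x\<in>A. ennreal \<bar>F x\<bar>) + (SUP x\<in>A. ennreal \<bar>G x\<bar>)"
  proof (rule SUP_least)
    fix x assume x: "x \<in> A"
    have "ennreal \<bar>(F + G) x\<bar> \<le> ennreal \<bar>F x\<bar> + ennreal \<bar>G x\<bar>"
      by (simp add: ennreal_leI abs_triangle_ineq flip: ennreal_plus)
    also have "\<dots> \<le> (SUP x\<in>A. ennreal \<bar>F x\<bar>) + (SUP x\<in>A. ennreal \<bar>G x\<bar>)"
      using x by (intro add_mono SUP_upper)
    finally show "ennreal \<bar>(F + G) x\<bar> \<le> \<dots>" .
  qed
qed

lemma bounded_in_singleton: "bounded_in T {x}"
  unfolding bounded_in_def
proof (intro allI impI)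
  fix U assume "0 \<in> T interior_of U"
  then have "0 \<in> U" by (rule subsetD[OF interior_of_subset])
  moreover have "x = x + 1 *\<^sub>R 0" by simp
  ultimately have "{x} \<subseteq> {e + 1 *\<^sub>R u | e u. e \<in> {x} \<and> u \<in> U}" by blast
  then show "\<exists>r>0. \<exists>E. finite E \<and> {x} \<subseteq> {e + r *\<^sub>R u | e u. e \<in> E \<and> u \<in> U}"
    by (intro exI[of _ 1] conjI exI[of _ "{x}"]) simp_all
qed

lemma bounded_in_seminorm_topology_imp:
  assumes q: "ext_seminorm q" "\<And>x. q x < \<infinity>" and A: "bounded_in (seminorm_topology UNIV {q}) A"
  obtains R where "R > 0" "\<And>x. x \<in> A \<Longrightarrow> q x \<le> ennreal R"
proof -
  have "openin (seminorm_topology UNIV {q}) {y. q (y - 0) < ennreal 1}"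
    by (rule ext_seminorm_ball_open[OF q(1)]) simp
  then have "0 \<in> seminorm_topology UNIV {q} interior_of {y. q y < 1}"
    using ext_seminorm_zero[OF q(1)] by (simp add: interior_of_openin)
  then obtain r E where r: "r > 0" and E: "finite E" "A \<subseteq> {e + r *\<^sub>R u | e u. e \<in> E \<and> u \<in> {y. q y < 1}}"
    using A unfolding bounded_in_def by meson
  define R where "R = (\<Sum>e\<in>E. enn2real (q e)) + r"
  have "q x \<le> ennreal R" if "x \<in> A" for x
  proof -
    from that E(2) obtain e u where x: "x = e + r *\<^sub>R u" "e \<in> E" "q u < 1" by blast
    have "ennreal r * q u \<le> ennreal r" using mult_left_mono[of "q u" 1 "ennreal r"] x(3) by simp
    then have ru: "q (r *\<^sub>R u) \<le> ennreal r" using ext_seminorm_scaleR[OF q(1)] r by simp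
    have "q x \<le> q e + q (r *\<^sub>R u)" using q(1) unfolding ext_seminorm_def x(1) by blast
    also have "\<dots> \<le> ennreal (enn2real (q e)) + ennreal r"
      using ru q(2)[of e] by (intro add_mono) (simp_all add: less_top)
    also have "\<dots> = ennreal (enn2real (q e) + r)" using r by simp
    also have "\<dots> \<le> ennreal R"
      unfolding R_def using E(1) x(2) by (intro ennreal_leI add_right_mono member_le_sum) auto
    finally show ?thesis .
  qed
  moreover have "R > 0" unfolding R_def using r by (intro add_nonneg_pos sum_nonneg) auto
  ultimately show ?thesis using that by blast
qed

lemma bounded_in_unit_ball:
  assumes q: "ext_seminorm q"
  shows "bounded_in (seminorm_topology UNIV {q}) {x. q x \<le> 1}"
  unfolding bounded_in_def
proof (intro allI impI)
  fix U assume U: "0 \<in> seminorm_topology UNIV {q} interior_of U"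
  obtain G r where G: "finite G" "G \<subseteq> {q}" "0 < r"
    "{y \<in> UNIV. \<forall>p\<in>G. p (y - 0) < ennreal r} \<subseteq> seminorm_topology UNIV {q} interior_of U"
    using openin_seminorm_topologyE[OF openin_interior_of U] .
  have "(r / 2) *\<^sub>R x \<in> U" if x: "q x \<le> 1" for x
  proof -
    have "q ((r / 2) *\<^sub>R x) = ennreal (r / 2) * q x" using ext_seminorm_scaleR[OF q] G(3) by simp
    also have "\<dots> \<le> ennreal (r / 2) * 1" using x by (intro mult_left_mono) auto
    also have "\<dots> < ennreal r" using G(3) by (simp add: ennreal_lessI)
    finally have "(r / 2) *\<^sub>R x \<in> seminorm_topology UNIV {q} interior_of U" using G(2,4) by auto
    then show ?thesis by (rule subsetD[OF interior_of_subset])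
  qed
  then show "\<exists>r>0. \<exists>E. finite E \<and> {x. q x \<le> 1} \<subseteq> {e + r *\<^sub>R u | e u. e \<in> E \<and> u \<in> U}"
    using G(3)
    by (intro exI[of _ "2 / r"] conjI exI[of _ "{0}"])
      (auto intro!: exI[of _ "(r / 2) *\<^sub>R _"])
qed

text \<open>
  In a seminormed space the bounded sets are those absorbed by the unit ball, so the dual carries
  the usual operator norm as its seminorm of uniform convergence on bounded sets. This norm is
  definite because \<open>q\<close> takes finite values, so that the unit ball absorbs every vector and
  a functional vanishing on the ball vanishes everywhere.
\<close>

lemma normable_ucb_seminormed:
  fixes q :: "'z::real_vector \<Rightarrow> ennreal"
  assumes q: "ext_seminorm q" "\<And>x. q x < \<infinity>"
  defines "T \<equiv> seminorm_topology UNIV {q}"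
  shows "normable (dual T) (tau_ucb T)"
  unfolding tau_ucb_def
proof (rule normable_of_dominating_norm[where q = "\<lambda>F. SUP x\<in>{x. q x \<le> 1}. ennreal \<bar>F x\<bar>"])
  let ?Q = "\<lambda>F. SUP x\<in>{x. q x \<le> 1}. ennreal \<bar>F x\<bar>"
  have absorb: "ennreal \<bar>F x\<bar> \<le> ennreal R * ?Q F"
    if F: "F \<in> dual T" and R: "R > 0" "q x \<le> ennreal R" for F R x
  proof -
    have lin: "linear F" using F unfolding dual_def by simp
    have "q ((1 / R) *\<^sub>R x) = ennreal (1 / R) * q x" using ext_seminorm_scaleR[OF q(1)] R by simp
    also have "\<dots> \<le> ennreal (1 / R) * ennreal R" using R by (intro mult_left_mono) auto
    also have "\<dots> = 1" using R by (simp flip: ennreal_mult)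
    finally have "ennreal \<bar>F ((1 / R) *\<^sub>R x)\<bar> \<le> ?Q F" by (intro SUP_upper) simp
    then have "ennreal R * ennreal \<bar>F ((1 / R) *\<^sub>R x)\<bar> \<le> ennreal R * ?Q F"
      by (intro mult_left_mono) auto
    then show ?thesis using linear_scale[OF lin] R(1) by (simp add: abs_mult flip: ennreal_mult)
  qed
  show "subspace (dual T)" by (rule subspace_dual)
  show "ext_seminorm ?Q" by (rule ext_seminorm_sup_on)
  show "?Q \<in> {\<lambda>F. SUP x\<in>A. ennreal \<bar>F x\<bar> | A. bounded_in T A}"
    using bounded_in_unit_ball[OF q(1)] unfolding T_def by blast
  show "?Q F < \<infinity>" if F: "F \<in> dual T" for F
  proof -
    obtain C where "\<And>x. q x \<le> 1 \<Longrightarrow> \<bar>F x\<bar> \<le> C"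
      using dual_bounded_on_unit_ball[OF q(1) F[unfolded T_def]] by blast
    then have "?Q F \<le> ennreal C" by (intro SUP_least ennreal_leI) simp
    then show ?thesis by (simp add: le_less_trans)
  qed
  show "F = 0" if F: "F \<in> dual T" and 0: "?Q F = 0" for F
  proof
    fix x
    have "q x \<le> ennreal (enn2real (q x) + 1)" using q(2)[of x] by (simp add: less_top)
    then have "ennreal \<bar>F x\<bar> \<le> ennreal (enn2real (q x) + 1) * ?Q F"
      by (intro absorb[OF F]) (simp add: add_nonneg_pos)
    then show "F x = 0 x" using 0 by simp
  qed
  fix p assume "p \<in> {\<lambda>F. SUP x\<in>A. ennreal \<bar>F x\<bar> | A. bounded_in T A}"
  then obtain A where A: "bounded_in T A" "p = (\<lambda>F. SUP x\<in>A. ennreal \<bar>F x\<bar>)" by blast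
  obtain R where R: "R > 0" "\<And>x. x \<in> A \<Longrightarrow> q x \<le> ennreal R"
    using bounded_in_seminorm_topology_imp[OF q A(1)[unfolded T_def]] by blast
  show "\<exists>C>0. \<forall>F\<in>dual T. p F \<le> ennreal C * ?Q F"
    unfolding A(2) using R absorb by (intro exI[of _ R] conjI ballI SUP_least) auto
qed

lemma normable_imp_normable_ucb:
  assumes "normable UNIV T"
  shows "normable (dual T) (tau_ucb T)"
proof -
  obtain N where N: "\<And>x. 0 \<le> N x" "\<And>c x. N (c *\<^sub>R x) = \<bar>c\<bar> * N x"
    "\<And>x y. N (x + y) \<le> N x + N y" "T = seminorm_topology UNIV {\<lambda>x. ennreal (N x)}"
    using assms unfolding normable_def by blast
  have "ext_seminorm (\<lambda>x. ennreal (N x))"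
    unfolding ext_seminorm_def using N by (auto simp: ennreal_mult ennreal_leI simp flip: ennreal_plus)
  then show ?thesis unfolding N(4) by (rule normable_ucb_seminormed) simp
qed


section \<open>Weights that dominate all continuous functions\<close>

lemma linear_eval: "linear (\<lambda>f. apply_cfun f x)"
  by (rule linearI) (simp_all add: plus_cfun.rep_eq scaleR_cfun.rep_eq)

lemma continuous_on_apply_cfun: "continuous_on UNIV (apply_cfun f)"
  using apply_cfun by simp

text \<open>
  A normable dual has finitely many bounded sets of functions controlling all others. Testing that
  control on point evaluations turns it into one weight function \<open>g\<close> on the underlying space, the
  sum of the suprema of \<open>\<bar>f x\<bar>\<close> over these bounded sets.
\<close>

lemma normable_ucb_imp_dominating_weight:
  fixes T :: "'a::topological_space cfun topology"
  assumes norm: "normable (dual T) (tau_ucb T)"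
    and eval: "\<And>x. (\<lambda>f. apply_cfun f x) \<in> dual T"
  obtains g :: "'a \<Rightarrow> real" where "\<And>x. g x \<ge> 0"
    "\<And>A. bounded_in T A \<Longrightarrow> \<exists>C>0. \<forall>f\<in>A. \<forall>x. \<bar>apply_cfun f x\<bar> \<le> C * g x"
proof -
  let ?P = "{\<lambda>F :: 'a cfun \<Rightarrow> real. SUP f\<in>A. ennreal \<bar>F f\<bar> | A. bounded_in T A}"
  have P: "ext_seminorm p" if "p \<in> ?P" for p using that ext_seminorm_sup_on by blast
  obtain G where G: "finite G" "G \<subseteq> ?P"
    and fin: "\<And>q F. q \<in> ?P \<Longrightarrow> F \<in> dual T \<Longrightarrow> q F < \<infinity>"
    and dom: "\<And>q. q \<in> ?P \<Longrightarrow> \<exists>C>0. \<forall>F\<in>dual T. \<forall>t\<ge>0.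
        (\<forall>p\<in>G. p F \<le> ennreal t) \<longrightarrow> q F \<le> ennreal (C * t)"
    using normable_imp_dominating_family[OF subspace_dual P norm[unfolded tau_ucb_def]] by blast
  define g where "g x = (\<Sum>p\<in>G. enn2real (p (\<lambda>f. apply_cfun f x)))" for x
  show ?thesis
  proof (rule that[of g])
    show g0: "g x \<ge> 0" for x unfolding g_def by (intro sum_nonneg) simp
    fix A assume A: "bounded_in T A"
    obtain C where C: "C > 0" "\<And>F t. F \<in> dual T \<Longrightarrow> t \<ge> 0 \<Longrightarrow>
        (\<forall>p\<in>G. p F \<le> ennreal t) \<Longrightarrow> (SUP f\<in>A. ennreal \<bar>F f\<bar>) \<le> ennreal (C * t)"
      using dom[of "\<lambda>F. SUP f\<in>A. ennreal \<bar>F f\<bar>"] A by blast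
    have "\<bar>apply_cfun f x\<bar> \<le> C * g x" if f: "f \<in> A" for f x
    proof -
      have "p (\<lambda>f. apply_cfun f x) \<le> ennreal (g x)" if p: "p \<in> G" for p
      proof -
        have "p (\<lambda>f. apply_cfun f x) = ennreal (enn2real (p (\<lambda>f. apply_cfun f x)))"
          using fin[OF subsetD[OF G(2) p] eval[of x]] by (simp add: less_top)
        also have "\<dots> \<le> ennreal (g x)"
          unfolding g_def using G(1) p by (intro ennreal_leI member_le_sum) auto
        finally show ?thesis .
      qed
      then have "(SUP f\<in>A. ennreal \<bar>apply_cfun f x\<bar>) \<le> ennreal (C * g x)"
        by (intro C(2)[OF eval] g0 ballI)
      moreover have "ennreal \<bar>apply_cfun f x\<bar> \<le> (SUP f\<in>A. ennreal \<bar>apply_cfun f x\<bar>)"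
        using f by (rule SUP_upper)
      ultimately have "ennreal \<bar>apply_cfun f x\<bar> \<le> ennreal (C * g x)" by (rule order_trans[rotated])
      then show ?thesis using C(1) g0[of x] by (simp add: ennreal_le_iff)
    qed
    then show "\<exists>C>0. \<forall>f\<in>A. \<forall>x. \<bar>apply_cfun f x\<bar> \<le> C * g x" using C(1) by blast
  qed
qed

text \<open>
  A non-compact metric space contains a closed discrete sequence \<open>t\<^sub>0, t\<^sub>1, \<dots>\<close>. Any values may be
  prescribed along it, by Tietze's theorem, in particular values outgrowing every multiple of \<open>g\<close>.
\<close>

lemma dominating_weight_imp_compact:
  fixes g :: "'a::metric_space \<Rightarrow> real"
  assumes g0: "\<And>x. g x \<ge> 0" and dom: "\<And>f. \<exists>C. \<forall>x. \<bar>apply_cfun f x\<bar> \<le> C * g x"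
  shows "compact (UNIV :: 'a set)"
proof (rule ccontr)
  assume "\<not> compact (UNIV :: 'a set)"
  then obtain S :: "'a set" where S: "infinite S" "\<And>x. \<not> x islimpt S"
    unfolding compact_eq_Bolzano_Weierstrass by auto
  obtain t :: "nat \<Rightarrow> 'a" where t: "inj t" "range t \<subseteq> S"
    using infinite_countable_subset[OF S(1)] by blast
  \<comment> \<open>A subset without limit points is closed, so \<open>range t\<close> is discrete as well.\<close>
  have closed: "closed K" if "K \<subseteq> range t" for K
    unfolding closed_limpt using islimpt_subset[of _ K S] S(2) that t(2) by blast
  define h where "h x = real (inv t x) * (g x + 1)" for x
  have "continuous_on (range t) h"
    unfolding continuous_on_closed_vimage[OF closed[OF order_refl]] by (auto intro: closed)
  then have cont: "continuous_map (subtopology euclidean (range t)) euclideanreal h" by simp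
  have cl: "closedin euclidean (range t)" using closed[of "range t"] by simp
  have "normal_space (euclidean :: 'a topology)"
    by (simp add: metrizable_imp_normal_space metrizable_space_euclidean)
  from Tietze_extension_realinterval[OF this cl is_interval_univ _ cont]
  obtain k where k: "continuous_map euclidean euclideanreal k" "\<And>x. x \<in> range t \<Longrightarrow> k x = h x"
    by (metis UNIV_not_empty subset_UNIV)
  have app: "apply_cfun (Cfun k) = k" using k(1) by (simp add: Cfun_inverse)
  obtain C where C: "\<And>x. \<bar>k x\<bar> \<le> C * g x" using dom[of "Cfun k"] app by auto
  obtain n :: nat where n: "n > \<bar>C\<bar>" using reals_Archimedean2 by blast
  have "real n * (g (t n) + 1) = k (t n)" using k(2)[of "t n"] t(1) by (simp add: h_def)
  also have "\<dots> \<le> C * g (t n)" using C[of "t n"] by simp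
  also have "\<dots> \<le> real n * g (t n)" using n g0 by (intro mult_right_mono) auto
  finally show False using n by (simp add: algebra_simps)
qed

lemma normable_ucb_imp_compact:
  fixes T :: "'a::metric_space cfun topology"
  assumes "normable (dual T) (tau_ucb T)" "\<And>x. (\<lambda>f. apply_cfun f x) \<in> dual T"
  shows "compact (UNIV :: 'a set)"
proof -
  obtain g :: "'a \<Rightarrow> real" where g: "\<And>x. g x \<ge> 0"
    "\<And>A. bounded_in T A \<Longrightarrow> \<exists>C>0. \<forall>f\<in>A. \<forall>x. \<bar>apply_cfun f x\<bar> \<le> C * g x"
    using normable_ucb_imp_dominating_weight[OF assms] by blast
  show ?thesis 
  proof (rule dominating_weight_imp_compact[OF g(1)])
    show "\<exists>C. \<forall>x. \<bar>apply_cfun f x\<bar> \<le> C * g x" for f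
      using g(2)[OF bounded_in_singleton[of T f]] by auto
  qed
qed


section \<open>The topologies on continuous functions\<close>

lemma bornology_singleton: "bornology \<B> \<Longrightarrow> {x} \<in> \<B>"
  unfolding bornology_def by (metis UNIV_I UnionE empty_not_insert empty_subsetI insert_subset)

lemma bornology_finite_union:
  assumes "bornology \<B>" "finite G" "G \<subseteq> \<B>"
  obtains C where "C \<in> \<B>" "\<And>A. A \<in> G \<Longrightarrow> A \<subseteq> C"
proof -
  have "\<exists>C\<in>\<B>. \<forall>A\<in>G. A \<subseteq> C"
    using assms(2,3)
  proof (induction G)
    case empty
    then show ?case using bornology_singleton[OF assms(1)] by blast
  next
    case (insert A G)
    then obtain C where "C \<in> \<B>" "\<forall>A\<in>G. A \<subseteq> C" by auto
    then show ?case using assms(1) insert.prems unfolding bornology_def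
      by (intro bexI[of _ "A \<union> C"]) auto
  qed
  then show ?thesis using that by blast
qed

lemma rho_upper: "x \<in> B \<Longrightarrow> ennreal \<bar>apply_cfun f x\<bar> \<le> rho B f"
  unfolding rho_def by (rule SUP_upper)

lemma rho_s_upper: "x \<in> B \<Longrightarrow> ennreal \<bar>apply_cfun f x\<bar> \<le> rho_s B f"
  unfolding rho_s_rho by (intro INF_greatest rho_upper) (auto simp: enlargement_def intro!: bexI[of _ x])

lemma eval_in_dual_tau_B: "bornology \<B> \<Longrightarrow> (\<lambda>f. apply_cfun f x) \<in> dual (tau_B \<B>)"
  unfolding tau_B_eq
  by (rule dual_dominatedI[OF linear_eval imageI[OF bornology_singleton[where x = x]]]) (simp_all add: rho_upper)

lemma eval_in_dual_tau_Bs: "bornology \<B> \<Longrightarrow> (\<lambda>f. apply_cfun f x) \<in> dual (tau_Bs \<B>)"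
  unfolding tau_Bs_eq
  by (rule dual_dominatedI[OF linear_eval imageI[OF bornology_singleton[where x = x]]]) (simp_all add: rho_s_upper)

lemma rho_finite_if_compact:
  assumes "compact (UNIV :: 'a::metric_space set)"
  shows "rho B (f :: 'a cfun) < \<infinity>"
proof -
  have "bounded (range (apply_cfun f))"
    using assms continuous_on_apply_cfun by (intro compact_imp_bounded compact_continuous_image)
  then obtain C where "\<And>x. \<bar>apply_cfun f x\<bar> \<le> C" unfolding bounded_iff by auto
  then have "rho B f \<le> ennreal C" unfolding rho_def by (intro SUP_least ennreal_leI)
  then show ?thesis by (simp add: le_less_trans)
qed

text \<open>Continuous functions on a compact space are uniformly continuous.\<close>

lemma rho_s_eq_rho_if_compact:
  assumes "compact (UNIV :: 'a::metric_space set)"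
  shows "rho_s B = (rho B :: 'a cfun \<Rightarrow> ennreal)"
proof (rule ext, rule antisym)
  fix f :: "'a cfun"
  show "rho B f \<le> rho_s B f" unfolding rho_def by (intro SUP_least rho_s_upper)
  show "rho_s B f \<le> rho B f"
  proof (rule ennreal_le_epsilon)
    fix e :: real assume e: "0 < e"
    have "uniformly_continuous_on UNIV (apply_cfun f)"
      using compact_uniformly_continuous[OF continuous_on_apply_cfun assms] .
    then obtain d where d: "d > 0" "\<And>x y. dist x y < d \<Longrightarrow> dist (apply_cfun f x) (apply_cfun f y) < e"
      using e unfolding uniformly_continuous_on_def by (metis UNIV_I dist_commute)
    have "rho_s B f \<le> rho (enlargement B d) f" unfolding rho_s_rho using d(1) by (intro INF_lower) simp
    also have "\<dots> \<le> rho B f + ennreal e"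
      unfolding rho_def[of "enlargement B d"]
    proof (rule SUP_least)
      fix x assume "x \<in> enlargement B d"
      then obtain y where y: "y \<in> B" "dist x y < d" unfolding enlargement_def by auto
      have "\<bar>apply_cfun f x\<bar> \<le> \<bar>apply_cfun f y\<bar> + e"
        using d(2)[OF y(2)] by (simp add: dist_real_def)
      then have "ennreal \<bar>apply_cfun f x\<bar> \<le> ennreal \<bar>apply_cfun f y\<bar> + ennreal e"
        using e by (simp add: ennreal_leI flip: ennreal_plus)
      also have "\<dots> \<le> rho B f + ennreal e" using rho_upper[OF y(1)] by (intro add_right_mono)
      finally show "ennreal \<bar>apply_cfun f x\<bar> \<le> rho B f + ennreal e" .
    qed
    finally show "rho_s B f \<le> rho B f + ennreal e" .
  qed
qed

lemma tau_Bs_eq_tau_B_if_compact: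
  fixes \<B> :: "'a::metric_space set set"
  assumes "compact (UNIV :: 'a set)"
  shows "tau_Bs \<B> = tau_B \<B>"
  unfolding tau_Bs_def tau_B_def rho_s_eq_rho_if_compact[OF assms] ..

lemma normable_tau_B_if_compact:
  fixes \<B> :: "'a::metric_space set set"
  assumes B: "bornology \<B>" and X: "compact (UNIV :: 'a set)" "UNIV \<in> \<B>"
  shows "normable UNIV (tau_B \<B>)"
  unfolding tau_B_eq[OF B]
proof (rule normable_of_dominating_norm[where q = "rho UNIV"])
  show "rho UNIV \<in> rho ` \<B>" using X(2) by (rule imageI)
  show "rho UNIV f < \<infinity>" for f :: "'a cfun" by (rule rho_finite_if_compact[OF X(1)])
  show "f = 0" if "rho UNIV f = 0" for f :: "'a cfun"
  proof -
    have "apply_cfun f x = 0" for x using rho_upper[of x UNIV f] that by simp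
    then show ?thesis by (simp add: apply_cfun_inject[symmetric] zero_cfun.rep_eq fun_eq_iff)
  qed
  show "\<exists>C>0. \<forall>f\<in>UNIV. p f \<le> ennreal C * rho UNIV f" if "p \<in> rho ` \<B>" for p
    using that by (intro exI[of _ 1]) (auto intro: rho_mono)
qed (auto intro: subspace_UNIV ext_seminorm_rho)

lemma finest_lc_eq_self:
  assumes "locally_convex T"
  shows "finest_lc T = T"
proof -
  have "topspace T = UNIV" using assms unfolding locally_convex_def by auto
  then have "is_finest_lc T (finest_lc T)" by (rule is_finest_lc_finest_lc)
  moreover have "coarser T T" unfolding coarser_def by simp
  ultimately show ?thesis using assms unfolding is_finest_lc_def by (intro coarser_antisym) auto
qed

lemma locally_convex_tau_B_if_compact:
  fixes \<B> :: "'a::metric_space set set"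
  assumes "bornology \<B>" "compact (UNIV :: 'a set)"
  shows "locally_convex (tau_B \<B>)"
  unfolding locally_convex_def tau_B_eq[OF assms(1)]
  using ext_seminorm_rho rho_finite_if_compact[OF assms(2)] by (intro exI[of _ "rho ` \<B>"]) auto

text \<open>
  If the weight ball were a neighborhood of \<open>0\<close> controlled by a proper closed subset \<open>C\<close>, a
  function vanishing on \<open>C\<close> and exceeding \<open>g\<close> at a point outside \<open>C\<close> would belong to it.
\<close>

lemma weight_ball_nbhd_imp_UNIV_mem:
  fixes \<B> :: "'a::metric_space set set" and g :: "'a \<Rightarrow> real"
  assumes B: "bornology \<B>" and base: "has_closed_base \<B>" and g0: "\<And>x. g x \<ge> 0"
    and nbhd: "0 \<in> tau_B \<B> interior_of {f. \<forall>x. \<bar>apply_cfun f x\<bar> \<le> g x}"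
  shows "UNIV \<in> \<B>"
proof -
  let ?S = "{f :: 'a cfun. \<forall>x. \<bar>apply_cfun f x\<bar> \<le> g x}"
  obtain F r where F: "finite F" "F \<subseteq> rho ` \<B>" "0 < r"
    "{y \<in> UNIV. \<forall>p\<in>F. p (y - 0) < ennreal r} \<subseteq> seminorm_topology UNIV (rho ` \<B>) interior_of ?S"
    using openin_seminorm_topologyE[OF openin_interior_of nbhd[unfolded tau_B_eq[OF B]]] .
  obtain G where G: "finite G" "G \<subseteq> \<B>" "F = rho ` G"
    using finite_subset_image[OF F(1,2)] by blast
  obtain C0 where C0: "C0 \<in> \<B>" "\<And>A. A \<in> G \<Longrightarrow> A \<subseteq> C0"
    using bornology_finite_union[OF B G(1,2)] by blast
  obtain C where C: "C \<in> \<B>" "closed C" "C0 \<subseteq> C"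
    using base C0(1) unfolding has_closed_base_def by blast
  have Cne: "C \<noteq> {}" using B C(1) unfolding bornology_def by blast
  have "x \<in> C" for x
  proof (rule ccontr)
    assume x: "x \<notin> C"
    define k where "k y = (g x + 1) * (infdist y C / infdist x C)" for y
    have ix: "infdist x C > 0" using x C(2) Cne by (simp add: infdist_pos_not_in_closed)
    have app: "apply_cfun (Cfun k) = k"
      by (rule Cfun_inverse) (use ix in \<open>auto simp: k_def intro!: continuous_intros\<close>)
    have "rho C (Cfun k) \<le> 0" unfolding rho_def app by (intro SUP_least) (simp add: k_def)
    then have "rho A (Cfun k) = 0" if "A \<in> G" for A
      using rho_mono[OF order_trans[OF C0(2)[OF that] C(3)], of "Cfun k"] by simp
    then have "Cfun k \<in> {y \<in> UNIV. \<forall>p\<in>F. p (y - 0) < ennreal r}" unfolding G(3) using F(3) by auto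
    then have "Cfun k \<in> ?S" by (rule subsetD[OF interior_of_subset subsetD[OF F(4)]])
    then have "\<bar>k x\<bar> \<le> g x" using app by simp
    moreover have "k x = g x + 1" unfolding k_def using ix by simp
    ultimately show False by simp
  qed
  then have "C = UNIV" by blast
  then show ?thesis using C(1) by simp
qed

text \<open>
  The weight ball is the barrel to which quasibarreledness is applied. Quasibarreledness is assumed
  of the finest locally convex topology, but compactness makes all the suprema finite, so that this
  topology is the original one.
\<close>

lemma quasibarreled_normable_ucb_imp_UNIV_mem:
  fixes \<B> :: "'a::metric_space set set"
  assumes B: "bornology \<B>" and base: "has_closed_base \<B>"
    and qb: "quasibarreled (finest_lc (tau_B \<B>))"
    and norm: "normable (dual (tau_B \<B>)) (tau_ucb (tau_B \<B>))"
  shows "UNIV \<in> \<B>"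
proof -
  let ?T = "tau_B \<B>"
  note eval = eval_in_dual_tau_B[OF B]
  have "compact (UNIV :: 'a set)" using normable_ucb_imp_compact[OF norm eval] .
  then have qbT: "quasibarreled ?T"
    using qb finest_lc_eq_self[OF locally_convex_tau_B_if_compact[OF B]] by simp
  obtain g :: "'a \<Rightarrow> real" where g0: "\<And>x. g x \<ge> 0"
    and g: "\<And>A. bounded_in ?T A \<Longrightarrow> \<exists>C>0. \<forall>f\<in>A. \<forall>x. \<bar>apply_cfun f x\<bar> \<le> C * g x"
    using normable_ucb_imp_dominating_weight[OF norm eval] by blast
  let ?S = "{f :: 'a cfun. \<forall>x. \<bar>apply_cfun f x\<bar> \<le> g x}"
  have "absolutely_convex ?S"
    unfolding absolutely_convex_def
  proof (intro conjI allI impI ballI)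
    show "convex ?S"
    proof (rule convexI)
      fix f h :: "'a cfun" and u v :: real
      assume fh: "f \<in> ?S" "h \<in> ?S" and uv: "0 \<le> u" "0 \<le> v" "u + v = 1"
      have "\<bar>u * apply_cfun f x + v * apply_cfun h x\<bar> \<le> g x" for x
      proof -
        have "\<bar>u * apply_cfun f x + v * apply_cfun h x\<bar> \<le> u * \<bar>apply_cfun f x\<bar> + v * \<bar>apply_cfun h x\<bar>"
          using abs_triangle_ineq[of "u * apply_cfun f x" "v * apply_cfun h x"] uv by (simp add: abs_mult)
        also have "\<dots> \<le> u * g x + v * g x" using fh uv by (intro add_mono mult_left_mono) auto
        also have "\<dots> = g x" using uv(3) by (simp flip: distrib_right)
        finally show ?thesis .
      qed
      then show "u *\<^sub>R f + v *\<^sub>R h \<in> ?S" by (simp add: plus_cfun.rep_eq scaleR_cfun.rep_eq)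
    qed
    fix c :: real and f :: "'a cfun" assume c: "\<bar>c\<bar> \<le> 1" and f: "f \<in> ?S"
    have "\<bar>c\<bar> * \<bar>apply_cfun f x\<bar> \<le> g x" for x
      using mult_mono[OF c, of "\<bar>apply_cfun f x\<bar>" "g x"] f by simp
    then show "c *\<^sub>R f \<in> ?S" by (simp add: scaleR_cfun.rep_eq abs_mult)
  qed
  moreover have "closedin ?T ?S"
  proof -
    have "closedin ?T {f \<in> topspace ?T. apply_cfun f x \<in> {- g x..g x}}" for x
      using eval[of x] unfolding dual_def
      by (intro closedin_continuous_map_preimage[where Y = euclideanreal]) auto
    then have "closedin ?T (\<Inter>x. {f. apply_cfun f x \<in> {- g x..g x}})"
      using B by (intro closedin_Inter) (auto simp: tau_B_eq)
    also have "(\<Inter>x. {f. apply_cfun f x \<in> {- g x..g x}}) = ?S" by (auto simp: abs_le_iff minus_le_iff)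
    finally show ?thesis .
  qed
  moreover have "absorbs ?S A" if A: "bounded_in ?T A" for A
  proof -
    obtain C where C: "C > 0" "\<forall>f\<in>A. \<forall>x. \<bar>apply_cfun f x\<bar> \<le> C * g x" using g[OF A] by blast
    have "f \<in> (*\<^sub>R) c ` ?S" if c: "C \<le> \<bar>c\<bar>" and f: "f \<in> A" for c f
    proof (rule image_eqI)
      show "f = c *\<^sub>R (inverse c *\<^sub>R f)" using c C(1) by auto
      have "\<bar>apply_cfun f x\<bar> \<le> \<bar>c\<bar> * g x" for x
        using C(2) f mult_right_mono[OF c g0[of x]] by (meson order_trans)
      then show "inverse c *\<^sub>R f \<in> ?S"
        using c C(1) by (auto simp: scaleR_cfun.rep_eq abs_mult field_simps)
    qed
    then show ?thesis unfolding absorbs_def using C(1) by blast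
  qed
  ultimately have "0 \<in> ?T interior_of ?S" using qbT unfolding quasibarreled_def by blast
  then show ?thesis by (rule weight_ball_nbhd_imp_UNIV_mem[OF B base g0])
qed

theorem theorem4p7:
  fixes \<B> :: "'a::metric_space set set"
  assumes "bornology \<B>"
    and "has_closed_base \<B>"
    and "quasibarreled (finest_lc (tau_B \<B>))"
  shows "(normable (dual (tau_B \<B>)) (tau_ucb (tau_B \<B>)) \<longleftrightarrow>
            normable (dual (tau_Bs \<B>)) (tau_ucb (tau_Bs \<B>))) \<and>
         (normable (dual (tau_Bs \<B>)) (tau_ucb (tau_Bs \<B>)) \<longleftrightarrow> normable UNIV (tau_B \<B>)) \<and>
         (normable UNIV (tau_B \<B>) \<longleftrightarrow> normable UNIV (tau_Bs \<B>)) \<and>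
         (normable UNIV (tau_Bs \<B>) \<longleftrightarrow> compact (UNIV :: 'a set) \<and> UNIV \<in> \<B>)"
proof -
  note B = assms(1)
  let ?n1 = "normable (dual (tau_B \<B>)) (tau_ucb (tau_B \<B>))"
  let ?n2 = "normable (dual (tau_Bs \<B>)) (tau_ucb (tau_Bs \<B>))"
  have 31: "normable UNIV (tau_B \<B>) \<Longrightarrow> ?n1" by (rule normable_imp_normable_ucb)
  have 42: "normable UNIV (tau_Bs \<B>) \<Longrightarrow> ?n2" by (rule normable_imp_normable_ucb)
  have c1: "compact (UNIV :: 'a set)" if ?n1
    using normable_ucb_imp_compact[OF that eval_in_dual_tau_B[OF B]] .
  have c2: "compact (UNIV :: 'a set)" if ?n2
    using normable_ucb_imp_compact[OF that eval_in_dual_tau_Bs[OF B]] .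
  have eq: "tau_Bs \<B> = tau_B \<B>" if "compact (UNIV :: 'a set)"
    using that by (rule tau_Bs_eq_tau_B_if_compact)
  have 15: "UNIV \<in> \<B>" if ?n1
    using quasibarreled_normable_ucb_imp_UNIV_mem[OF assms that] .
  have 53: "normable UNIV (tau_B \<B>)" if "compact (UNIV :: 'a set)" "UNIV \<in> \<B>"
    using normable_tau_B_if_compact[OF B that] .
  show ?thesis using 31 42 c1 c2 eq 15 53 by metis
qed

end
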